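(* Let $\psi : [0,\infty) \to [0,\infty)$ be a measurable function such that $0 < 1/c_d := \int_0^\infty u^d \psi(u)\,{\rm d}u < \infty$ for all integers $d \ge 1$, and assume $\psi$ does not have compact support. For each $d \ge 1$, let $X_d$ be a random vector in $\mathbb{R}^{d+1}$ with density $x \mapsto c_d\,\psi(\|x\|)$, and let $U_d = \|X_d\|$. Assume there is $u_\ddagger$ such that on $[u_\ddagger, \infty)$ the function $\Lambda(u) := -\log \psi(u)$ is differentiable and $L(u) := u \Lambda'(u)$ is increasing; that $M(u) := L(u)/\log u \to \infty$ as $u \to \infty$; and that for every $\varepsilon \in (0,1)$, $\limsup_{u\to\infty} M((1-\varepsilon)u)/M(u) \le 1$ and $\liminf_{u\to\infty} M((1+\varepsilon)u)/M(u) \ge 1$. Let $u_d := L^{-1}(d)$. Assume further that $L$ is differentiable, that $\nu_d := u_d L'(u_d) \to \infty$ as $d\to\infty$, and that there is a sequence $\omega_d \to \infty$ such that $$\big|L(u_d) - L((1-\varepsilon)u_d) - \varepsilon u_d L'(u_d)\big| \le |\varepsilon|\,\nu_d/\omega_d \quad \text{whenever } \varepsilon^2 \le \omega_d/\nu_d.$$ Then $\sqrt{\nu_d}\,(U_d/u_d - 1)$ converges in distribution to the standard normal distribution as $d \to \infty$.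
   Context: $L^{-1}$ denotes the inverse of the increasing function $L$ on $[u_\ddagger,\infty)$, so $L(u_d)=d$ for $d$ large.
   Formalization: The constant c_d in the density c_d ψ(‖x‖) is taken to be the one that normalizes it, not 1/∫u^d ψ(u)du, which omits the surface area of the sphere (for d=1 the total mass would be 2π); the condition 0 < ∫u^d ψ < ∞ is kept separately. *)

theory Defs
  imports "HOL-Probability.Probability"
begin

text \<open>Euclidean norm of a vector in R^(d+1), represented as a function on the
  index set {0..d} (elements of the space of PiM {..d} (\<lambda>_. lborel)).\<close>
definition vnorm :: "nat \<Rightarrow> (nat \<Rightarrow> real) \<Rightarrow> real" where
  "vnorm d x = sqrt (\<Sum>i\<le>d. (x i)\<^sup>2)"

definition Linv :: "real \<Rightarrow> (real \<Rightarrow> real) \<Rightarrow> real \<Rightarrow> real" where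
  "Linv a L y = the_inv_into {a..} L y"

end

theory Submission
  imports Defs
begin

text \<open>
  In polar coordinates the norm has a density proportional to \<open>u\<^sup>d \<psi>(u)\<close>. Its logarithm has derivative
  \<open>(d - L(u)) / u\<close>, so it is concave as a function of \<open>ln u\<close> and peaks at \<open>u\<^sub>d\<close>. At
  \<open>u = u\<^sub>d (1 + s / \<surd>\<nu>\<^sub>d)\<close> the linearisation of \<open>L\<close> gives \<open>L(u) - d \<approx> s \<surd>\<nu>\<^sub>d\<close>, hence the
  normalised density tends pointwise to \<open>exp (- s\<^sup>2 / 2)\<close>. Monotonicity of \<open>L\<close> extends its size at
  \<open>s = \<plusminus> 4\<close> to all larger \<open>\<bar>s\<bar>\<close>, which yields an integrable majorant of order \<open>1 / (1 + s\<^sup>2)\<close>, so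
  dominated convergence applies on \<open>[a, \<infinity>)\<close> for a fixed \<open>a\<close>. The mass of \<open>[0, a]\<close> is
  negligible because \<open>u\<^sup>d \<psi>(u)\<close> at \<open>u = u\<^sub>d\<close> is at least its value at \<open>u = 2 a\<close>, which beats
  \<open>a\<^sup>d\<close> geometrically, whereas \<open>\<surd>\<nu>\<^sub>d\<close> grows at most linearly in \<open>d\<close>.
\<close>

section \<open>The law of the norm of a radially distributed vector\<close>

lemma vnorm_nonneg [simp]: "0 \<le> vnorm d x"
  by (simp add: vnorm_def sum_nonneg)

lemma borel_measurable_vnorm [measurable]:
  "vnorm d \<in> borel_measurable (PiM {..d} (\<lambda>_. lborel))"
  unfolding vnorm_def by measurable

text \<open>For \<open>r > 0\<close> this is the volume of a Euclidean ball in dimension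
  \<open>d + 1\<close>. The ball of radius 0 lies inside every ball of positive radius, and the
  volumes of those tend to 0.\<close>

lemma emeasure_vnorm_le:
  assumes "0 \<le> r"
  shows "emeasure (PiM {..d} (\<lambda>_. lborel)) {x \<in> space (PiM {..d} (\<lambda>_. lborel)). vnorm d x \<le> r} =
    ennreal (unit_ball_vol (real (Suc d)) * r ^ Suc d)"
proof (cases "r = 0")
  case False
  then show ?thesis
    using emeasure_cball_aux[of "{..d}" r] assms
    by (simp add: vnorm_def Int_def conj_commute)
next
  case True
  let ?P = "PiM {..d} (\<lambda>_. lborel :: real measure)"
  let ?S = "\<lambda>r. {x \<in> space ?P. vnorm d x \<le> r}"
  let ?f = "\<lambda>r. ennreal (unit_ball_vol (real (Suc d)) * r ^ Suc d)"
  have pos: "emeasure ?P (?S r) = ?f r" if "r > 0" for r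
    using emeasure_cball_aux[of "{..d}" r] that
    by (simp add: vnorm_def Int_def conj_commute)
  have "((\<lambda>r. ?f r) \<longlongrightarrow> ?f 0) (at_right 0)"
    by (intro tendsto_ennrealI tendsto_intros)
  moreover have "\<forall>\<^sub>F r in at_right 0. emeasure ?P (?S 0) \<le> ?f r"
    using eventually_at_right_less[of "0::real"]
  proof eventually_elim
    case (elim r)
    have "emeasure ?P (?S 0) \<le> emeasure ?P (?S r)"
      using elim by (intro emeasure_mono) auto
    then show ?case
      using pos elim by simp
  qed
  ultimately have "emeasure ?P (?S 0) \<le> ?f 0"
    by (intro tendsto_lowerbound) (auto simp: trivial_limit_at_right_real)
  then show ?thesis
    using True by simp
qed

text \<open>Polar coordinates without spherical measure: the density is the derivative of the ball
  volume in the radius. Agreement on the half-lines \<open>{..r}\<close> suffices, since these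
  generate the Borel sets and are closed under intersection.\<close>

lemma distr_vnorm:
  "distr (PiM {..d} (\<lambda>_. lborel)) borel (vnorm d) =
    density lborel (\<lambda>u. ennreal (real (Suc d) * unit_ball_vol (real (Suc d)) * u ^ d) * indicator {0..} u)"
  (is "?D = density lborel ?f")
proof (rule measure_eqI_generator_eq[where E = "range atMost" and \<Omega> = UNIV and A = "\<lambda>n. {..real n}"])
  let ?V = "unit_ball_vol (real (Suc d))"
  have D: "emeasure ?D {..r} = (if r < 0 then 0 else ennreal (?V * r ^ Suc d))" for r
  proof -
    have "emeasure ?D {..r} = emeasure (PiM {..d} (\<lambda>_. lborel))
        {x \<in> space (PiM {..d} (\<lambda>_. lborel)). vnorm d x \<le> r}"
      by (subst emeasure_distr) (auto intro!: arg_cong2[where f = emeasure])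
    moreover have "vnorm d x \<le> r \<longleftrightarrow> False" if "r < 0" for x
      using that vnorm_nonneg[of d x] by (auto simp: not_le simp del: vnorm_nonneg)
    ultimately show ?thesis
      using emeasure_vnorm_le[of r d] by (auto simp del: vnorm_nonneg)
  qed
  have F: "emeasure (density lborel ?f) {..r} = (if r < 0 then 0 else ennreal (?V * r ^ Suc d))" for r
  proof -
    have "emeasure (density lborel ?f) {..r} =
        (\<integral>\<^sup>+u. ennreal (real (Suc d) * ?V * u ^ d) * indicator {0..r} u \<partial>lborel)"
      by (subst emeasure_density) (auto intro!: nn_integral_cong simp: indicator_def)
    also have "\<dots> = (if r < 0 then 0 else ennreal (?V * r ^ Suc d))"
    proof (cases "r < 0")
      case False
      have "(\<integral>\<^sup>+u. ennreal (real (Suc d) * ?V * u ^ d) * indicator {0..r} u \<partial>lborel) =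
          ennreal (?V * r ^ Suc d - ?V * 0 ^ Suc d)"
      proof (rule nn_integral_FTC_Icc)
        fix x :: real assume "x \<in> {0..r}"
        show "((\<lambda>u. ?V * u ^ Suc d) has_real_derivative real (Suc d) * ?V * x ^ d) (at x)"
          using DERIV_cmult[OF DERIV_pow[of "Suc d" x UNIV], of ?V] by (simp add: mult_ac)
      qed (use False in auto)
      then show ?thesis
        using False by simp
    qed auto
    finally show ?thesis .
  qed
  show "emeasure ?D X = emeasure (density lborel ?f) X" if "X \<in> range atMost" for X
    using that D F by auto
  show "emeasure ?D {..real n} \<noteq> \<infinity>" for n
    by (simp add: D)
  show "(\<Union>n. {..real n}) = UNIV"
    using real_arch_simple by auto
  show "Int_stable (range (atMost :: real \<Rightarrow> _))"
    by (auto simp: Int_stable_def)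
qed (auto simp: borel_eq_atMost)

text \<open>The normalising constant never has to be computed: the event \<open>UNIV\<close> has
  probability 1, which forces the product of \<open>c\<close> and the sphere area to be the
  reciprocal of the total integral. The factor \<open>indicator {0..}\<close> is there because
  nothing is assumed about \<open>\<psi>\<close> on the negative axis.\<close>

lemma measure_radial_norm:
  fixes \<psi> :: "real \<Rightarrow> real"
  assumes \<psi> [measurable]: "(\<lambda>u. indicator {0..} u * \<psi> u) \<in> borel_measurable borel"
    and nonneg: "\<And>u. 0 \<le> u \<Longrightarrow> 0 \<le> \<psi> u"
    and int: "integrable lborel (\<lambda>u. u ^ d * (indicator {0..} u * \<psi> u))"
    and M: "prob_space M"
    and X: "distributed M (PiM {..d} (\<lambda>_. lborel)) X (\<lambda>x. ennreal (c * \<psi> (vnorm d x)))"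
    and B [measurable]: "B \<in> sets borel"
  shows "measure (distr M borel (\<lambda>s. vnorm d (X s))) B =
    (\<integral>u. indicator B u * (u ^ d * (indicator {0..} u * \<psi> u)) \<partial>lborel) /
    (\<integral>u. u ^ d * (indicator {0..} u * \<psi> u) \<partial>lborel)"
proof -
  interpret prob_space M by fact
  let ?P = "PiM {..d} (\<lambda>_. lborel :: real measure)"
  let ?q = "\<lambda>u. u ^ d * (indicator {0..} u * \<psi> u)"
  define V where "V = real (Suc d) * unit_ball_vol (real (Suc d))"
  have V: "0 \<le> V"
    unfolding V_def by (intro mult_nonneg_nonneg unit_ball_vol_nonneg) auto
  have q: "0 \<le> ?q u" for u
    using nonneg by (auto simp: indicator_def)
  have [measurable]: "X \<in> measurable M ?P"
    using X by (rule distributed_measurable)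
  then have X_space: "s \<in> space M \<Longrightarrow> X s \<in> space ?P" for s
    by (rule measurable_space)
  \<comment> \<open>No sign is assumed for \<open>c\<close>, so the constant is kept in the
    truncated form \<open>ennreal c\<close>; \<open>norm\<close> below shows that it is
    positive.\<close>
  have prob: "prob {s \<in> space M. vnorm d (X s) \<in> A} =
      enn2real (ennreal c * ennreal V) * (\<integral>u. indicator A u * ?q u \<partial>lborel)"
    if [measurable]: "A \<in> sets borel" for A
  proof -
    have intA: "integrable lborel (\<lambda>u. indicator A u * ?q u)"
      using integrable_mult_indicator[OF _ int, of A] by (simp only: real_scaleR_def sets_lborel that)
    have nonnegA: "AE u in lborel. 0 \<le> indicator A u * ?q u"
      by (intro AE_I2 mult_nonneg_nonneg q indicator_pos_le)
    have "emeasure M {s \<in> space M. vnorm d (X s) \<in> A} =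
        emeasure (distr M ?P X) {x \<in> space ?P. vnorm d x \<in> A}"
      by (subst emeasure_distr) (auto intro!: arg_cong2[where f = emeasure] X_space)
    also have "\<dots> = (\<integral>\<^sup>+x. ennreal (c * \<psi> (vnorm d x)) * indicator {x \<in> space ?P. vnorm d x \<in> A} x \<partial>?P)"
      unfolding distributed_distr_eq_density[OF X]
      using distributed_borel_measurable[OF X] by (subst emeasure_density) auto
    also have "\<dots> = (\<integral>\<^sup>+x. ennreal (c * (indicator {0..} (vnorm d x) * \<psi> (vnorm d x))) * indicator A (vnorm d x) \<partial>?P)"
      by (intro nn_integral_cong) (auto simp: indicator_def)
    also have "\<dots> = (\<integral>\<^sup>+u. ennreal (c * (indicator {0..} u * \<psi> u)) * indicator A u \<partial>distr ?P borel (vnorm d))"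
      by (subst nn_integral_distr) auto
    also have "\<dots> = (\<integral>\<^sup>+u. (ennreal (V * u ^ d) * indicator {0..} u) *
        (ennreal (c * (indicator {0..} u * \<psi> u)) * indicator A u) \<partial>lborel)"
      unfolding distr_vnorm V_def by (subst nn_integral_density) auto
    also have "\<dots> = (\<integral>\<^sup>+u. (ennreal c * ennreal V) * ennreal (indicator A u * ?q u) \<partial>lborel)"
      using V nonneg
      by (intro nn_integral_cong) (auto simp: indicator_def ennreal_mult'' ac_simps)
    also have "\<dots> = (ennreal c * ennreal V) * ennreal (\<integral>u. indicator A u * ?q u \<partial>lborel)"
      by (subst nn_integral_cmult, measurable, subst nn_integral_eq_integral[OF intA nonnegA]) simp
    finally show ?thesis
      using integral_nonneg_AE[OF nonnegA] by (simp add: measure_def enn2real_mult)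
  qed
  have norm: "enn2real (ennreal c * ennreal V) * (\<integral>u. ?q u \<partial>lborel) = 1"
    using prob[of UNIV] prob_space by simp
  then have "(\<integral>u. ?q u \<partial>lborel) \<noteq> 0"
    by force
  with norm have "enn2real (ennreal c * ennreal V) = 1 / (\<integral>u. ?q u \<partial>lborel)"
    by (simp only: nonzero_eq_divide_eq not_False_eq_True)
  moreover have "measure (distr M borel (\<lambda>s. vnorm d (X s))) B = prob {s \<in> space M. vnorm d (X s) \<in> B}"
    by (subst measure_distr) (auto intro!: arg_cong2[where f = measure])
  ultimately show ?thesis
    unfolding prob[OF B] by (simp only: times_divide_eq_left mult_1_left)
qed

section \<open>The logarithm of the rescaled density\<close>

text \<open>The analysis for one fixed dimension. On \<open>{a..}\<close> the point
  \<open>u0\<close> is where \<open>u ^ n * exp (- \<Lambda> u)\<close> peaks; \<open>r\<close> is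
  the scaling factor, later \<open>sqrt (\<nu> d)\<close>. Since \<open>L\<close> is controlled only
  from \<open>a\<close> on, a bound at \<open>s\<close> needs \<open>a \<le> pt s\<close>, which is
  automatic for \<open>0 \<le> s\<close> only.\<close>

locale log_profile =
  fixes \<Lambda> L :: "real \<Rightarrow> real" and a u0 r n :: real
  assumes a_pos: "0 < a"
    and \<Lambda>_deriv: "\<And>u. a \<le> u \<Longrightarrow> (\<Lambda> has_real_derivative L u / u) (at u)"
    and L_mono: "\<And>u v. a \<le> u \<Longrightarrow> u \<le> v \<Longrightarrow> L u \<le> L v"
    and L_u0: "L u0 = n"
    and a_le_u0: "a \<le> u0"
    and r_pos: "0 < r"
begin

text \<open>
  \<open>H s\<close> is the logarithm of \<open>u\<^sup>n exp (- \<Lambda> u)\<close> at \<open>u = pt s\<close>, normalised by its value at \<open>u0\<close>.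
\<close>

definition pt :: "real \<Rightarrow> real" where
  "pt s = u0 * (1 + s / r)"

definition H :: "real \<Rightarrow> real" where
  "H s = n * ln (1 + s / r) - \<Lambda> (pt s) + \<Lambda> u0"

lemma u0_pos: "0 < u0"
  using a_pos a_le_u0 by simp

lemma pt_mono: "s \<le> t \<Longrightarrow> pt s \<le> pt t"
  using u0_pos r_pos by (simp add: pt_def divide_right_mono)

lemma pt_0 [simp]: "pt 0 = u0"
  by (simp add: pt_def)

lemma H_0 [simp]: "H 0 = 0"
  by (simp add: H_def)

lemma r_add_pos: "a \<le> pt s \<Longrightarrow> 0 < r + s"
proof -
  assume "a \<le> pt s"
  then have "0 < u0 * (1 + s / r)"
    using a_pos by (simp add: pt_def)
  then have "0 < 1 + s / r"
    using u0_pos zero_less_mult_pos by blast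
  then show ?thesis
    using r_pos by (simp add: field_simps)
qed

text \<open>The logarithmic derivative of \<open>pt\<close> is \<open>1 / (r + s)\<close>, the same
  factor that the derivative of \<open>ln (1 + s / r)\<close> gives. Hence the sign of the slope is
  that of \<open>n - L (pt s)\<close>.\<close>

lemma H_deriv:
  assumes "a \<le> pt s"
  shows "(H has_real_derivative (n - L (pt s)) / (r + s)) (at s)"
proof -
  have rs: "0 < r + s"
    using assms by (rule r_add_pos)
  then have pos: "0 < 1 + s / r"
    using r_pos by (simp add: field_simps)
  have pt: "(pt has_real_derivative u0 / r) (at s)"
    unfolding pt_def[abs_def] using r_pos by (auto intro!: derivative_eq_intros)
  have deriv_\<Lambda>: "((\<lambda>s. \<Lambda> (pt s)) has_real_derivative L (pt s) / pt s * (u0 / r)) (at s)"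
    by (rule DERIV_chain2[OF \<Lambda>_deriv[OF assms] pt])
  have "L (pt s) / pt s * (u0 / r) = L (pt s) / (r + s)"
  proof -
    have "pt s * r = u0 * (r + s)"
      using r_pos by (simp add: pt_def field_simps)
    then show ?thesis
      using u0_pos by simp
  qed
  moreover have deriv_ln: "((\<lambda>s. n * ln (1 + s / r)) has_real_derivative n / (r + s)) (at s)"
    using pos r_pos rs by (auto intro!: derivative_eq_intros simp: field_simps)
  ultimately show ?thesis
    unfolding H_def[abs_def]
    using DERIV_add[OF DERIV_diff[OF deriv_ln deriv_\<Lambda>] DERIV_const[of "\<Lambda> u0"]]
    by (simp add: diff_divide_distrib)
qed

text \<open>\<open>L\<close> increases through the value \<open>n\<close> at \<open>u0\<close>, so
  the slope of \<open>H\<close> turns from nonnegative to nonpositive at 0, where \<open>H\<close>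
  vanishes.\<close>

lemma H_nonpos:
  assumes "a \<le> pt s"
  shows "H s \<le> 0"
proof (cases "0 \<le> s")
  case True
  have "H s \<le> H 0"
  proof (rule DERIV_nonpos_imp_nonincreasing[OF True])
    fix t assume t: "0 \<le> t" "t \<le> s"
    then have "u0 \<le> pt t"
      using pt_mono[of 0 t] by simp
    then have at: "a \<le> pt t" and "n \<le> L (pt t)"
      using a_le_u0 L_mono[of u0 "pt t"] L_u0 by auto
    then show "\<exists>y. (H has_real_derivative y) (at t) \<and> y \<le> 0"
      using H_deriv[OF at] r_add_pos[OF at] by (intro exI conjI) (auto simp: divide_nonpos_pos)
  qed
  then show ?thesis by simp
next
  case False
  have "H s \<le> H 0"
  proof (rule DERIV_nonneg_imp_nondecreasing[where f = H])
    fix t assume t: "s \<le> t" "t \<le> 0"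
    then have at: "a \<le> pt t" and "pt t \<le> u0"
      using pt_mono[of s t] assms pt_mono[of t 0] by auto
    then have "L (pt t) \<le> n"
      using L_mono[of "pt t" u0] L_u0 by auto
    then show "\<exists>y. (H has_real_derivative y) (at t) \<and> 0 \<le> y"
      using H_deriv[OF at] r_add_pos[OF at] by (intro exI conjI) auto
  qed (use False in simp)
  then show ?thesis by simp
qed

text \<open>Beyond \<open>T\<close> monotonicity keeps \<open>L - n\<close> at least
  \<open>T * r / 2\<close>, half of what the linearisation predicts at \<open>T\<close>. The slope
  of \<open>H\<close> is then at most \<open>- T / 2 * (r / (r + s))\<close>, and integrating gives
  a multiple of \<open>r * ln (1 + s / r)\<close>. For \<open>1 \<le> r\<close> this function lies
  between \<open>ln (1 + s)\<close> and \<open>s\<close>, which removes \<open>r\<close> from the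
  final bound.\<close>

lemma H_le_right:
  assumes T: "0 \<le> T" "T * r / 2 \<le> L (pt T) - n" and s: "0 \<le> s" and r: "1 \<le> r"
  shows "H s \<le> T\<^sup>2 / 2 - T / 2 * ln (1 + s)"
proof -
  have ge: "a \<le> pt t" if "0 \<le> t" for t
    using pt_mono[OF that] a_le_u0 by simp
  let ?g = "\<lambda>s. r * ln (1 + s / r)"
  have g_le: "?g t \<le> t" if "0 \<le> t" for t
    using ln_add_one_self_le_self[of "t / r"] that r_pos by (simp add: field_simps)
  have g_ge: "ln (1 + t) \<le> ?g t" if "0 \<le> t" for t
  proof -
    have "?g 0 - ln (1 + 0) \<le> ?g t - ln (1 + t)"
    proof (rule DERIV_nonneg_imp_nondecreasing[where f = "\<lambda>t. ?g t - ln (1 + t)", OF that])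
      fix x :: real assume x: "0 \<le> x" "x \<le> t"
      have "((\<lambda>t. ?g t - ln (1 + t)) has_real_derivative r / (r + x) - 1 / (1 + x)) (at x)"
        using x r_pos by (auto intro!: derivative_eq_intros simp: field_simps add_pos_nonneg)
      moreover have "x \<le> r * x"
        using x r by (simp add: mult_le_cancel_right1)
      then have "0 \<le> r / (r + x) - 1 / (1 + x)"
        using x r_pos by (simp add: field_simps add_pos_nonneg)
      ultimately show "\<exists>y. ((\<lambda>t. ?g t - ln (1 + t)) has_real_derivative y) (at x) \<and> 0 \<le> y"
        by blast
    qed
    then show ?thesis
      by simp
  qed
  show ?thesis
  \<comment> \<open>Up to \<open>T\<close> the claimed bound is nonnegative and
    \<open>H_nonpos\<close> is enough; the constant \<open>T\<^sup>2 / 2\<close> is chosen for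
    this.\<close>
  proof (cases "s \<le> T")
    case True
    have "T / 2 * ln (1 + s) \<le> T / 2 * s"
      using T s ln_add_one_self_le_self[of s] by (intro mult_left_mono) auto
    also have "\<dots> \<le> T / 2 * T"
      using T True by (intro mult_left_mono) auto
    finally show ?thesis
      using H_nonpos[OF ge[OF s]] by (simp add: power2_eq_square)
  next
    case False
    have "H s + T / 2 * ?g s \<le> H T + T / 2 * ?g T"
    proof (rule DERIV_nonpos_imp_nonincreasing[where f = "\<lambda>s. H s + T / 2 * ?g s"])
      fix t assume t: "T \<le> t" "t \<le> s"
      then have at: "a \<le> pt t"
        using T by (intro ge) auto
      have "T * r / 2 \<le> L (pt t) - n"
        using T(2) L_mono[OF ge[OF T(1)] pt_mono[OF t(1)]] by simp
      then have "((n - L (pt t)) + T / 2 * r) / (r + t) \<le> 0"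
        using r_add_pos[OF at] by (intro divide_nonpos_pos) auto
      moreover have "(?g has_real_derivative r / (r + t)) (at t)"
        using r_pos t T by (auto intro!: derivative_eq_intros simp: field_simps add_pos_nonneg)
      then have "((\<lambda>s. H s + T / 2 * ?g s) has_real_derivative
          ((n - L (pt t)) / (r + t) + T / 2 * (r / (r + t)))) (at t)"
        by (intro DERIV_add H_deriv[OF at] DERIV_cmult)
      ultimately show "\<exists>y. ((\<lambda>s. H s + T / 2 * ?g s) has_real_derivative y) (at t) \<and> y \<le> 0"
        by (intro exI conjI) (auto simp: add_divide_distrib)
    qed (use False in simp)
    moreover have "T / 2 * ?g T \<le> T / 2 * T" "T / 2 * ln (1 + s) \<le> T / 2 * ?g s"
      using T s g_le[of T] g_ge[of s] by (intro mult_left_mono; simp)+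
    moreover have "H T \<le> 0"
      by (intro H_nonpos ge T)
    ultimately show ?thesis
      by (simp add: power2_eq_square)
  qed
qed

text \<open>Left of the peak the denominator \<open>r + t\<close> is smaller than \<open>r\<close>,
  which helps: the slope of \<open>H\<close> is at least \<open>T / 2\<close> outright, so the decay
  is exponential.\<close>

lemma H_le_left:
  assumes T: "0 \<le> T" "T * r / 2 \<le> n - L (pt (- T))" and s: "s \<le> 0" "a \<le> pt s"
  shows "H s \<le> T\<^sup>2 / 2 + T / 2 * s"
proof (cases "- T \<le> s")
  case True
  have "T / 2 * (- s) \<le> T / 2 * T"
    using T True by (intro mult_left_mono) auto
  then show ?thesis
    using H_nonpos[OF s(2)] by (simp add: power2_eq_square)
next
  case False
  have "H s - T / 2 * s \<le> H (- T) - T / 2 * (- T)"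
  proof (rule DERIV_nonneg_imp_nondecreasing[where f = "\<lambda>s. H s - T / 2 * s"])
    fix t assume t: "s \<le> t" "t \<le> - T"
    then have at: "a \<le> pt t"
      using s pt_mono[of s t] by auto
    have "T / 2 * (r + t) \<le> T / 2 * r"
      using t T by (intro mult_left_mono) auto
    also have "\<dots> \<le> n - L (pt t)"
      using T(2) L_mono[OF at pt_mono[OF t(2)]] by simp
    finally have "T / 2 \<le> (n - L (pt t)) / (r + t)"
      using r_add_pos[OF at] by (simp add: pos_le_divide_eq)
    then show "\<exists>y. ((\<lambda>s. H s - T / 2 * s) has_real_derivative y) (at t) \<and> 0 \<le> y"
      using H_deriv[OF at]
      by (intro exI[of _ "(n - L (pt t)) / (r + t) - T / 2"]) (auto intro!: derivative_eq_intros)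
  qed (use False in simp)
  moreover have "H (- T) \<le> 0"
    using pt_mono[of s "-T"] s False by (intro H_nonpos) auto
  ultimately show ?thesis
    by (simp add: power2_eq_square)
qed

text \<open>With \<open>T = 4\<close> the right tail decays like \<open>(1 + s)\<close> to the power
  -2, which is integrable, and \<open>T\<^sup>2 / 2 = 8\<close>. On the left the exponential bound
  is weakened to the same shape by \<open>ln (1 + \<bar>s\<bar>) \<le> \<bar>s\<bar>\<close>. The
  majorant depends on neither \<open>r\<close> nor \<open>n\<close>.\<close>

lemma H_le:
  assumes right: "4 * r / 2 \<le> L (pt 4) - n" and left: "4 * r / 2 \<le> n - L (pt (- 4))"
    and s: "a \<le> pt s" and r: "1 \<le> r"
  shows "exp (H s) \<le> exp 8 * inverse (1 + s\<^sup>2)"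
proof -
  have "H s \<le> 8 - 2 * ln (1 + \<bar>s\<bar>)"
  proof (cases "0 \<le> s")
    case True
    then show ?thesis
      using H_le_right[of 4 s] right r by simp
  next
    case False
    then show ?thesis
      using H_le_left[of 4 s] left s ln_add_one_self_le_self[of "\<bar>s\<bar>"] by simp
  qed
  then have "exp (H s) \<le> exp (8 - 2 * ln (1 + \<bar>s\<bar>))"
    by simp
  also have "\<dots> = exp 8 / (1 + \<bar>s\<bar>)\<^sup>2"
    by (simp add: exp_diff exp_double add_pos_nonneg)
  also have "\<dots> \<le> exp 8 / (1 + s\<^sup>2)"
    by (intro divide_left_mono) (auto simp: power2_sum add_pos_nonneg)
  finally show ?thesis
    by (simp add: divide_inverse)
qed

text \<open>Mean value inequality for \<open>H s + s\<^sup>2 / 2\<close>. Its slope has two errors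
  over \<open>r + t\<close>: the linearisation error of \<open>L\<close>, and
  \<open>t\<^sup>2\<close>, which arises because the denominator is \<open>r + t\<close> instead of
  \<open>r\<close>.\<close>

lemma H_gaussian:
  assumes T: "\<And>t. \<bar>t\<bar> \<le> \<bar>s\<bar> \<Longrightarrow> \<bar>L (pt t) - n - t * r\<bar> \<le> \<bar>t\<bar> * r / w"
    and s: "a \<le> pt (- \<bar>s\<bar>)" and r: "\<bar>s\<bar> < r" and w: "0 < w"
  shows "\<bar>H s + s\<^sup>2 / 2\<bar> \<le> (\<bar>s\<bar> * r / w + s\<^sup>2) / (r - \<bar>s\<bar>) * \<bar>s\<bar>"
proof -
  let ?g = "\<lambda>s. H s + s\<^sup>2 / 2"
  have "norm (?g s - ?g 0) \<le> (\<bar>s\<bar> * r / w + s\<^sup>2) / (r - \<bar>s\<bar>) * norm (s - 0)"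
  proof (rule field_differentiable_bound[where S = "{- \<bar>s\<bar>..\<bar>s\<bar>}"])
    fix t assume "t \<in> {- \<bar>s\<bar>..\<bar>s\<bar>}"
    then have t: "\<bar>t\<bar> \<le> \<bar>s\<bar>" and "- \<bar>s\<bar> \<le> t"
      by auto
    then have at: "a \<le> pt t"
      using pt_mono[of "- \<bar>s\<bar>" t] s by linarith
    show "(?g has_field_derivative (n - L (pt t)) / (r + t) + t) (at t within {- \<bar>s\<bar>..\<bar>s\<bar>})"
      using H_deriv[OF at, THEN has_field_derivative_at_within]
      by (auto intro!: derivative_eq_intros)
    have rt: "0 < r + t"
      using at by (rule r_add_pos)
    have "(n - L (pt t)) / (r + t) + t = (t\<^sup>2 - (L (pt t) - n - t * r)) / (r + t)"
      using rt by (simp add: field_simps power2_eq_square)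
    then have "norm ((n - L (pt t)) / (r + t) + t) = \<bar>t\<^sup>2 - (L (pt t) - n - t * r)\<bar> / (r + t)"
      using rt by simp
    also have "\<dots> \<le> (\<bar>s\<bar> * r / w + s\<^sup>2) / (r - \<bar>s\<bar>)"
    proof (rule frac_le)
      have "\<bar>t\<bar> * r / w \<le> \<bar>s\<bar> * r / w"
        using t w r_pos by (intro divide_right_mono mult_right_mono) auto
      moreover have "t\<^sup>2 \<le> s\<^sup>2"
        using t by (rule abs_le_square_iff[THEN iffD1])
      ultimately show "\<bar>t\<^sup>2 - (L (pt t) - n - t * r)\<bar> \<le> \<bar>s\<bar> * r / w + s\<^sup>2"
        using T[OF t] zero_le_power2[of t] by linarith
      show "0 \<le> \<bar>s\<bar> * r / w + s\<^sup>2"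
        using r_pos w by simp
    qed (use r t in auto)
    finally show "norm ((n - L (pt t)) / (r + t) + t) \<le> (\<bar>s\<bar> * r / w + s\<^sup>2) / (r - \<bar>s\<bar>)" .
  qed auto
  then show ?thesis
    by simp
qed

end

lemma (in log_profile) exp_H:
  assumes \<Lambda>: "\<Lambda> = (\<lambda>x. - ln (\<phi> x))" and n: "n = real d"
    and pos: "\<And>x. a \<le> x \<Longrightarrow> 0 < \<phi> x" and s: "a \<le> pt s"
  shows "exp (H s) = pt s ^ d * \<phi> (pt s) / (u0 ^ d * \<phi> u0)"
proof -
  have "0 < 1 + s / r"
    using r_add_pos[OF s] r_pos by (simp add: field_simps)
  moreover have "H s = real d * ln (1 + s / r) + ln (\<phi> (pt s)) - ln (\<phi> u0)"
    by (subst H_def) (simp add: \<Lambda> n)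
  ultimately have "exp (H s) = (1 + s / r) ^ d * \<phi> (pt s) / \<phi> u0"
    using pos[OF s] pos[OF a_le_u0]
    by (simp add: exp_diff exp_add exp_of_nat_mult)
  then show ?thesis
    using u0_pos by (simp add: pt_def power_mult_distrib)
qed

section \<open>Convergence of the rescaled densities\<close>

text \<open>\<open>A\<close> is arbitrary so that half-lines give the numerator of the distribution
  function and \<open>UNIV\<close> its normalising constant.\<close>

lemma laplace_limit:
  fixes \<phi> L :: "real \<Rightarrow> real" and u r w :: "nat \<Rightarrow> real" and a :: real
  defines "p \<equiv> \<lambda>d s. u d * (1 + s / r d)"
  assumes \<phi>_meas [measurable]: "\<phi> \<in> borel_measurable borel"
    and \<phi>_nonneg: "\<And>x. 0 \<le> \<phi> x"
    and \<phi>_neg: "\<And>x. x < 0 \<Longrightarrow> \<phi> x = 0"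
    and \<phi>_int: "integrable lborel (\<lambda>x. x * \<phi> x)"
    and a: "0 < a"
    and \<phi>_pos: "\<And>x. a \<le> x \<Longrightarrow> 0 < \<phi> x"
    and deriv: "\<And>x. a \<le> x \<Longrightarrow> ((\<lambda>x. - ln (\<phi> x)) has_real_derivative L x / x) (at x)"
    and L_mono: "\<And>x y. a \<le> x \<Longrightarrow> x \<le> y \<Longrightarrow> L x \<le> L y"
    and u: "filterlim u at_top sequentially"
    and r: "filterlim r at_top sequentially"
    and w: "filterlim w at_top sequentially"
    and Lu: "\<forall>\<^sub>F d in sequentially. L (u d) = real d"
    and bound: "\<forall>\<^sub>F d in sequentially. \<forall>t. t\<^sup>2 \<le> w d \<longrightarrow>
      \<bar>L (p d t) - real d - t * r d\<bar> \<le> \<bar>t\<bar> * r d / w d"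
    and A [measurable]: "A \<in> sets borel"
  shows "(\<lambda>d. \<integral>s. indicator A s * (p d s ^ d * \<phi> (p d s) / (u d ^ d * \<phi> (u d))) \<partial>lborel)
    \<longlonglongrightarrow> (\<integral>s. indicator A s * exp (- s\<^sup>2 / 2) \<partial>lborel)"
proof -
  define G where "G d s = p d s ^ d * \<phi> (p d s) / (u d ^ d * \<phi> (u d))" for d s
  \<comment> \<open>What holds for all large \<open>d\<close>. The terms \<open>2 * r d\<close> are
    the requirement of \<open>H_le\<close> at \<open>T = 4\<close>; the bound on \<open>r d\<close>
    by \<open>2 * (real d - L a)\<close> says that the scale grows at most linearly, which is needed
    for the mass below \<open>a\<close>.\<close>
  define good where "good d \<longleftrightarrow> log_profile (\<lambda>x. - ln (\<phi> x)) L a (u d) (r d) (real d) \<and>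
    1 \<le> r d \<and> 2 * r d \<le> L (p d 4) - real d \<and> 2 * r d \<le> real d - L (p d (- 4)) \<and>
    r d \<le> 2 * (real d - L a) \<and> 1 \<le> d" for d
  have [measurable]: "p d \<in> borel_measurable borel" for d
    unfolding p_def by measurable
  have [measurable]: "G d \<in> borel_measurable borel" for d
    unfolding G_def by measurable
  have inv_r: "(\<lambda>d. c / r d) \<longlonglongrightarrow> 0" for c
    by (rule real_tendsto_divide_at_top[OF tendsto_const r])
  have inv_w: "(\<lambda>d. c / w d) \<longlonglongrightarrow> 0" for c
    by (rule real_tendsto_divide_at_top[OF tendsto_const w])
  have p_top: "filterlim (\<lambda>d. p d s) at_top sequentially" for s
  proof -
    have "(\<lambda>d. 1 + s / r d) \<longlonglongrightarrow> 1 + 0"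
      by (intro tendsto_intros inv_r)
    then have "filterlim (\<lambda>d. (1 + s / r d) * u d) at_top sequentially"
      by (intro filterlim_tendsto_pos_mult_at_top[OF _ _ u]) auto
    then show ?thesis
      by (simp add: p_def mult.commute)
  qed
  have p_ge: "\<forall>\<^sub>F d in sequentially. a \<le> p d s" for s
    using p_top[of s] by (simp add: filterlim_at_top)
  have good: "\<forall>\<^sub>F d in sequentially. good d"
  proof -
    \<comment> \<open>The threshold 16 admits \<open>t = 4\<close> and \<open>t = -4\<close> in
      \<open>bound\<close>, and it makes the error at most half of the linear term.\<close>
    have "\<forall>\<^sub>F d in sequentially. a \<le> u d" "\<forall>\<^sub>F d in sequentially. 1 \<le> r d"
      "\<forall>\<^sub>F d in sequentially. 16 \<le> w d"
      using u r w by (simp_all add: filterlim_at_top)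
    then show ?thesis
      using Lu bound p_ge[of "-1"] eventually_ge_at_top[of 1]
    proof eventually_elim
      case (elim d)
      have prof: "log_profile (\<lambda>x. - ln (\<phi> x)) L a (u d) (r d) (real d)"
        using elim a deriv L_mono by unfold_locales auto
      have small: "\<bar>t\<bar> * r d / w d \<le> \<bar>t\<bar> * r d / 2" for t
        using elim by (intro divide_left_mono) auto
      have le: "\<bar>L (p d t) - real d - t * r d\<bar> \<le> \<bar>t\<bar> * r d / 2" if "t\<^sup>2 \<le> 16" for t
        using elim that small[of t] by (meson order_trans)
      \<comment> \<open>At \<open>t = -1\<close> the linearisation gives
        \<open>L (p d (- 1)) \<le> real d - r d / 2\<close>, whence the linear bound on
        \<open>r d\<close>.\<close>
      have "L a \<le> L (p d (- 1))"
        using elim by (intro L_mono) auto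
      then show ?case
        using prof elim le[of 4] le[of "-4"] le[of "-1", THEN abs_le_D1] by (auto simp: good_def abs_le_iff)
    qed
  qed
  have G_nonneg: "0 \<le> G d s" if "good d" for d s
  proof -
    interpret P: log_profile "\<lambda>x. - ln (\<phi> x)" L a "u d" "r d" "real d"
      using that by (simp add: good_def)
    have "0 \<le> p d s ^ d * \<phi> (p d s)"
      using \<phi>_nonneg[of "p d s"] \<phi>_neg[of "p d s"] by (cases "p d s < 0") auto
    then show ?thesis
      using \<phi>_nonneg[of "u d"] P.u0_pos by (simp add: G_def)
  qed
  have G_exp: "G d s = exp (log_profile.H (\<lambda>x. - ln (\<phi> x)) (u d) (r d) (real d) s)"
    if "good d" "a \<le> p d s" for d s
  proof -
    interpret P: log_profile "\<lambda>x. - ln (\<phi> x)" L a "u d" "r d" "real d"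
      using that by (simp add: good_def)
    show ?thesis
      using P.exp_H[OF refl refl \<phi>_pos, of s] that by (simp add: G_def p_def P.pt_def)
  qed

  \<comment> \<open>The integrand is split at \<open>p d s = a\<close>. Making \<open>G1\<close>
    vanish when \<open>d\<close> is not good lets the majorant hold for every \<open>d\<close>, as
    dominated convergence demands.\<close>
  define G1 where "G1 d s = indicator A s * (if good d \<and> a \<le> p d s then G d s else 0)" for d s
  define G2 where "G2 d s = indicator A s * (if good d \<and> \<not> a \<le> p d s then G d s else 0)" for d s
  have [measurable]: "G1 d \<in> borel_measurable borel" "G2 d \<in> borel_measurable borel" for d
    unfolding G1_def G2_def by measurable

  have dom: "integrable lborel (\<lambda>s::real. exp 8 * inverse (1 + s\<^sup>2))"
    using integrable_inverse_1_plus_square by (simp add: set_integrable_def einterval_def)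
  have G1_bound: "norm (G1 d s) \<le> exp 8 * inverse (1 + s\<^sup>2)" for d s
  proof (cases "good d \<and> a \<le> p d s")
    case True
    interpret P: log_profile "\<lambda>x. - ln (\<phi> x)" L a "u d" "r d" "real d"
      using True by (simp add: good_def)
    have "exp (P.H s) \<le> exp 8 * inverse (1 + s\<^sup>2)"
      using True by (intro P.H_le) (auto simp: good_def P.pt_def p_def)
    then have "G d s \<le> exp 8 * inverse (1 + s\<^sup>2)"
      using G_exp True by simp
    then show ?thesis
      using True G_nonneg[of d s] by (auto simp: G1_def indicator_def)
  qed (auto simp: G1_def)
  have G1_lim: "(\<lambda>d. G1 d s) \<longlonglongrightarrow> indicator A s * exp (- s\<^sup>2 / 2)" for s
  proof -
    define H where "H d = log_profile.H (\<lambda>x. - ln (\<phi> x)) (u d) (r d) (real d) s" for d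
    \<comment> \<open>The error bound of \<open>H_gaussian\<close> with numerator and denominator
      divided by \<open>r d\<close>, so that its limit is visible.\<close>
    define b where "b d = (\<bar>s\<bar> / w d + s\<^sup>2 / r d) / (1 - \<bar>s\<bar> / r d) * \<bar>s\<bar>" for d
    have "b \<longlonglongrightarrow> (0 + 0) / (1 - 0) * \<bar>s\<bar>"
      unfolding b_def by (intro tendsto_intros inv_r inv_w) auto
    then have b: "b \<longlonglongrightarrow> 0"
      by simp
    have "\<forall>\<^sub>F d in sequentially. \<bar>s\<bar> + 1 \<le> r d" "\<forall>\<^sub>F d in sequentially. s\<^sup>2 + 1 \<le> w d"
      using r w by (simp_all add: filterlim_at_top)
    then have "\<forall>\<^sub>F d in sequentially. norm (H d + s\<^sup>2 / 2) \<le> b d"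
      using good bound p_ge[of "- \<bar>s\<bar>"]
    proof eventually_elim
      case (elim d)
      interpret P: log_profile "\<lambda>x. - ln (\<phi> x)" L a "u d" "r d" "real d"
        using elim by (simp add: good_def)
      have w_pos: "0 < w d"
        using elim zero_le_power2[of s] by linarith
      have "\<bar>P.H s + s\<^sup>2 / 2\<bar> \<le> (\<bar>s\<bar> * r d / w d + s\<^sup>2) / (r d - \<bar>s\<bar>) * \<bar>s\<bar>"
      proof (rule P.H_gaussian)
        fix t :: real assume "\<bar>t\<bar> \<le> \<bar>s\<bar>"
        then have "t\<^sup>2 \<le> s\<^sup>2"
          by (rule abs_le_square_iff[THEN iffD1])
        then have "t\<^sup>2 \<le> w d"
          using elim by linarith
        then show "\<bar>L (P.pt t) - real d - t * r d\<bar> \<le> \<bar>t\<bar> * r d / w d"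
          using elim by (simp add: P.pt_def p_def)
      qed (use elim w_pos in \<open>auto simp: P.pt_def p_def\<close>)
      also have "(\<bar>s\<bar> * r d / w d + s\<^sup>2) / (r d - \<bar>s\<bar>) = (\<bar>s\<bar> / w d + s\<^sup>2 / r d) / (1 - \<bar>s\<bar> / r d)"
      proof -
        have "\<bar>s\<bar> * r d / w d + s\<^sup>2 = (\<bar>s\<bar> / w d + s\<^sup>2 / r d) * r d"
          using P.r_pos by (simp add: field_simps)
        moreover have "r d - \<bar>s\<bar> = (1 - \<bar>s\<bar> / r d) * r d"
          using P.r_pos by (simp add: field_simps)
        ultimately show ?thesis
          using P.r_pos by simp
      qed
      finally show ?case
        by (simp add: H_def b_def)
    qed
    then have "(\<lambda>d. H d + s\<^sup>2 / 2) \<longlonglongrightarrow> 0"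
      using b by (rule Lim_null_comparison)
    then have "(\<lambda>d. (H d + s\<^sup>2 / 2) - s\<^sup>2 / 2) \<longlonglongrightarrow> 0 - s\<^sup>2 / 2"
      by (intro tendsto_intros)
    then have "(\<lambda>d. indicator A s * exp (H d)) \<longlonglongrightarrow> indicator A s * exp (- s\<^sup>2 / 2)"
      by (intro tendsto_mult tendsto_const tendsto_exp) simp
    moreover have "\<forall>\<^sub>F d in sequentially. indicator A s * exp (H d) = G1 d s"
      using good p_ge[of s] by eventually_elim (simp add: G1_def H_def G_exp)
    ultimately show ?thesis
      by (rule Lim_transform_eventually)
  qed
  have G1_int: "integrable lborel (G1 d)" for d
    by (rule Bochner_Integration.integrable_bound[OF dom]) (use G1_bound in auto)
  have lim1: "(\<lambda>d. \<integral>s. G1 d s \<partial>lborel) \<longlonglongrightarrow> (\<integral>s. indicator A s * exp (- s\<^sup>2 / 2) \<partial>lborel)"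
    by (rule integral_dominated_convergence[OF _ _ dom]) (use G1_lim G1_bound in auto)

  define K where "K = (\<integral>x. x * \<phi> x \<partial>lborel)"
  have K: "0 \<le> K"
    unfolding K_def using \<phi>_nonneg \<phi>_neg
    by (intro integral_nonneg_AE AE_I2) (metis linorder_not_less mult_nonneg_nonneg mult_zero_right order_refl)
  define C where "C = 2 * K / (a\<^sup>2 * \<phi> (2 * a))"
  have C: "0 \<le> C"
    using K a \<phi>_nonneg[of "2 * a"] by (simp add: C_def)
  \<comment> \<open>Below \<open>a\<close> one has \<open>x ^ d \<le> x * a ^ (d - 1)\<close>; one
    factor \<open>x\<close> is kept because only \<open>x * \<phi> x\<close> is known to be
    integrable. The peak value is at least that at \<open>2 * a\<close>, which gives the power of
    1/2, and the substitution contributes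
    \<open>r d / u d \<le> 2 * (real d - L a) / a\<close>.\<close>
  have G2_bound: "integrable lborel (G2 d) \<and> norm (\<integral>s. G2 d s \<partial>lborel) \<le> (1 / 2) ^ d * (real d - L a) * C"
    if d: "good d" for d
  proof -
    interpret P: log_profile "\<lambda>x. - ln (\<phi> x)" L a "u d" "r d" "real d"
      using d by (simp add: good_def)
    define k where "k = a ^ (d - 1) / (u d ^ d * \<phi> (u d))"
    have a_pow: "a ^ d = a * a ^ (d - 1)"
      using d by (cases d) (auto simp: good_def)
    have den: "(2 * a) ^ d * \<phi> (2 * a) \<le> u d ^ d * \<phi> (u d)"
    proof -
      \<comment> \<open>The parameter at which \<open>p d\<close> reaches \<open>2 * a\<close>;
        \<open>H_nonpos\<close> there compares the peak with this point.\<close>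
      define s where "s = (2 * a / u d - 1) * r d"
      have s: "p d s = 2 * a"
        using P.u0_pos P.r_pos by (simp add: s_def p_def)
      then have "P.H s \<le> 0"
        using a by (intro P.H_nonpos) (simp add: P.pt_def p_def)
      then have "G d s \<le> 1"
        using G_exp[OF d, of s] s a by simp
      moreover have "0 < u d ^ d * \<phi> (u d)"
        using P.u0_pos \<phi>_pos[OF P.a_le_u0] by simp
      ultimately show ?thesis
        by (simp add: G_def s pos_divide_le_eq)
    qed
    have den_pos: "0 < (2 * a) ^ d * \<phi> (2 * a)"
      using a \<phi>_pos[of "2 * a"] by simp
    have k: "0 \<le> k"
      using den den_pos a by (simp add: k_def)
    have k_le: "k \<le> (1 / 2) ^ d / (a * \<phi> (2 * a))"
    proof -
      have "k \<le> a ^ (d - 1) / ((2 * a) ^ d * \<phi> (2 * a))"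
        unfolding k_def using den den_pos a by (intro divide_left_mono) auto
      also have "\<dots> = (1 / 2) ^ d / (a * \<phi> (2 * a))"
        using a by (simp add: power_mult_distrib a_pow power_one_over)
      finally show ?thesis .
    qed
    have p_eq: "p d = (\<lambda>s. u d + u d / r d * s)"
      by (simp add: p_def fun_eq_iff algebra_simps)
    have ur: "u d / r d \<noteq> 0" "0 < u d / r d"
      using P.u0_pos P.r_pos by auto
    have int_p: "integrable lborel (\<lambda>s. k * (p d s * \<phi> (p d s)))"
      unfolding p_eq
      by (intro integrable_mult_right lborel_integrable_real_affine[where f = "\<lambda>x. x * \<phi> x"] \<phi>_int ur)
    have val_p: "(\<integral>s. k * (p d s * \<phi> (p d s)) \<partial>lborel) = k * (r d / u d * K)"
    proof -
      have "K = \<bar>u d / r d\<bar> *\<^sub>R (\<integral>s. p d s * \<phi> (p d s) \<partial>lborel)"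
        unfolding p_eq K_def by (rule lborel_integral_real_affine[OF ur(1)])
      then show ?thesis
        using ur P.u0_pos P.r_pos by simp
    qed
    have G2_le: "norm (G2 d s) \<le> k * (p d s * \<phi> (p d s))" for s
    proof (cases "0 \<le> p d s")
      case False
      then show ?thesis
        using \<phi>_neg[of "p d s"] by (simp add: G2_def G_def)
    next
      case True
      have "G d s \<le> k * (p d s * \<phi> (p d s))" if "p d s < a"
      proof -
        have "p d s ^ d = p d s * p d s ^ (d - 1)"
          using d by (cases d) (auto simp: good_def)
        also have "\<dots> \<le> p d s * a ^ (d - 1)"
          using True that by (intro mult_left_mono power_mono) auto
        finally have "p d s ^ d * \<phi> (p d s) \<le> p d s * a ^ (d - 1) * \<phi> (p d s)"
          using \<phi>_nonneg by (intro mult_right_mono) auto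
        then have "G d s \<le> p d s * a ^ (d - 1) * \<phi> (p d s) / (u d ^ d * \<phi> (u d))"
          unfolding G_def using den den_pos by (intro divide_right_mono) auto
        then show ?thesis
          by (simp add: k_def mult_ac)
      qed
      moreover have "0 \<le> k * (p d s * \<phi> (p d s))"
        using k True \<phi>_nonneg by simp
      ultimately show ?thesis
        using G_nonneg[OF d] by (auto simp: G2_def indicator_def)
    qed
    have int: "integrable lborel (G2 d)"
    proof (rule Bochner_Integration.integrable_bound[OF int_p])
      show "AE s in lborel. norm (G2 d s) \<le> norm (k * (p d s * \<phi> (p d s)))"
        by (intro AE_I2 order_trans[OF G2_le]) simp
    qed measurable
    have "norm (\<integral>s. G2 d s \<partial>lborel) \<le> (\<integral>s. k * (p d s * \<phi> (p d s)) \<partial>lborel)"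
      by (rule Bochner_Integration.integral_norm_bound_integral[OF int int_p G2_le])
    also have "\<dots> = k * (r d / u d * K)"
      by (rule val_p)
    also have "\<dots> \<le> ((1 / 2) ^ d / (a * \<phi> (2 * a))) * (2 * (real d - L a) / a * K)"
      using k_le k K a P.r_pos P.a_le_u0 d
      by (intro mult_mono frac_le) (auto simp: good_def)
    also have "\<dots> = (1 / 2) ^ d * (real d - L a) * C"
      using a \<phi>_pos[of "2 * a"] by (simp add: C_def power2_eq_square field_simps)
    finally show ?thesis
      using int by simp
  qed
  have "(\<lambda>d. (real d * (1 / 2) ^ d - L a * (1 / 2) ^ d) * C) \<longlonglongrightarrow> (0 - L a * 0) * C"
    by (intro tendsto_mult[OF tendsto_diff[OF powser_times_n_limit_0 tendsto_mult[OF tendsto_const LIMSEQ_power_zero]]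
          tendsto_const]) auto
  then have lim0: "(\<lambda>d. (real d * (1 / 2) ^ d - L a * (1 / 2) ^ d) * C) \<longlonglongrightarrow> 0"
    by simp
  have "\<forall>\<^sub>F d in sequentially. norm (\<integral>s. G2 d s \<partial>lborel) \<le> (real d * (1 / 2) ^ d - L a * (1 / 2) ^ d) * C"
    using good
  proof eventually_elim
    case (elim d)
    then show ?case
      using G2_bound[of d] by (simp add: algebra_simps)
  qed
  then have lim2: "(\<lambda>d. \<integral>s. G2 d s \<partial>lborel) \<longlonglongrightarrow> 0"
    using lim0 by (rule Lim_null_comparison)
  have "\<forall>\<^sub>F d in sequentially. (\<integral>s. G1 d s \<partial>lborel) + (\<integral>s. G2 d s \<partial>lborel) =
      (\<integral>s. indicator A s * G d s \<partial>lborel)"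
    using good
  proof eventually_elim
    case (elim d)
    then have "(\<integral>s. G1 d s \<partial>lborel) + (\<integral>s. G2 d s \<partial>lborel) = (\<integral>s. G1 d s + G2 d s \<partial>lborel)"
      using G1_int G2_bound by (intro Bochner_Integration.integral_add[symmetric]) auto
    also have "\<dots> = (\<integral>s. indicator A s * G d s \<partial>lborel)"
      using elim by (intro Bochner_Integration.integral_cong) (auto simp: G1_def G2_def)
    finally show ?case .
  qed
  moreover have "(\<lambda>d. (\<integral>s. G1 d s \<partial>lborel) + (\<integral>s. G2 d s \<partial>lborel)) \<longlonglongrightarrow>
      (\<integral>s. indicator A s * exp (- s\<^sup>2 / 2) \<partial>lborel) + 0"
    by (intro tendsto_add lim1 lim2)
  ultimately show ?thesis
    unfolding G_def by (simp add: Lim_transform_eventually)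
qed

section \<open>Asymptotic normality of the rescaled norm\<close>

theorem theorem4:
  fixes \<psi> :: "real \<Rightarrow> real"
    and c :: "nat \<Rightarrow> real"
    and M :: "nat \<Rightarrow> 'a measure"
    and X :: "nat \<Rightarrow> 'a \<Rightarrow> nat \<Rightarrow> real"
    and udd :: real
    and \<Lambda>' :: "real \<Rightarrow> real"
    and L' :: "real \<Rightarrow> real"
    and \<omega> :: "nat \<Rightarrow> real"
  assumes psi_meas: "set_borel_measurable borel {0..} \<psi>"
    and psi_nonneg: "\<And>u. 0 \<le> u \<Longrightarrow> 0 \<le> \<psi> u"
    and moments: "\<And>d. 1 \<le> d \<Longrightarrow>
        0 < (\<integral>\<^sup>+ u. ennreal (u ^ d * \<psi> u) * indicator {0..} u \<partial>lborel) \<and>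
        (\<integral>\<^sup>+ u. ennreal (u ^ d * \<psi> u) * indicator {0..} u \<partial>lborel) < \<infinity>"
    and not_compact_supp: "\<not> compact (closure {u. 0 \<le> u \<and> \<psi> u \<noteq> 0})"
    and prob: "\<And>d. 1 \<le> d \<Longrightarrow> prob_space (M d)"
    and distr_X: "\<And>d. 1 \<le> d \<Longrightarrow>
        distributed (M d) (PiM {..d} (\<lambda>_. lborel)) (X d) (\<lambda>x. ennreal (c d * \<psi> (vnorm d x)))"
    and psi_pos: "\<And>u. udd \<le> u \<Longrightarrow> 0 < \<psi> u"
    and Lambda_deriv: "\<And>u. udd \<le> u \<Longrightarrow>
        ((\<lambda>v. - ln (\<psi> v)) has_real_derivative \<Lambda>' u) (at u within {udd..})"
    and L_incr: "strict_mono_on {udd..} (\<lambda>u. u * \<Lambda>' u)"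
    and M_infty: "filterlim (\<lambda>u. (u * \<Lambda>' u) / ln u) at_top at_top"
    and M_lower: "\<And>\<epsilon>. 0 < \<epsilon> \<Longrightarrow> \<epsilon> < 1 \<Longrightarrow>
        Limsup at_top (\<lambda>u. ereal ((((1 - \<epsilon>) * u) * \<Lambda>' ((1 - \<epsilon>) * u) / ln ((1 - \<epsilon>) * u))
                                 / ((u * \<Lambda>' u) / ln u))) \<le> 1"
    and M_upper: "\<And>\<epsilon>. 0 < \<epsilon> \<Longrightarrow> \<epsilon> < 1 \<Longrightarrow>
        Liminf at_top (\<lambda>u. ereal ((((1 + \<epsilon>) * u) * \<Lambda>' ((1 + \<epsilon>) * u) / ln ((1 + \<epsilon>) * u))
                                 / ((u * \<Lambda>' u) / ln u))) \<ge> 1"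
    and L_deriv: "\<And>u. udd \<le> u \<Longrightarrow>
        ((\<lambda>v. v * \<Lambda>' v) has_real_derivative L' u) (at u within {udd..})"
    and nu_infty: "filterlim (\<lambda>d. Linv udd (\<lambda>u. u * \<Lambda>' u) (real d)
                                 * L' (Linv udd (\<lambda>u. u * \<Lambda>' u) (real d))) at_top sequentially"
    and omega_infty: "filterlim \<omega> at_top sequentially"
    and omega_bound: "\<forall>\<^sub>F d in sequentially. \<forall>\<epsilon>::real.
        (let L = (\<lambda>u. u * \<Lambda>' u); ud = Linv udd L (real d); \<nu> = ud * L' ud in
         \<epsilon>\<^sup>2 \<le> \<omega> d / \<nu> \<longrightarrow>
         \<bar>L ud - L ((1 - \<epsilon>) * ud) - \<epsilon> * ud * L' ud\<bar> \<le> \<bar>\<epsilon>\<bar> * \<nu> / \<omega> d)"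
  shows "weak_conv_m
          (\<lambda>d. distr (M d) borel
             (\<lambda>s. let L = (\<lambda>u. u * \<Lambda>' u); ud = Linv udd L (real d); \<nu> = ud * L' ud in
                  sqrt \<nu> * (vnorm d (X d s) / ud - 1)))
          std_normal_distribution"
proof -
  define L where "L = (\<lambda>u. u * \<Lambda>' u)"
  define u where "u d = Linv udd L (real d)" for d :: nat
  define \<nu> where "\<nu> d = u d * L' (u d)" for d
  define r where "r d = sqrt (\<nu> d)" for d
  \<comment> \<open>Strictly beyond \<open>udd\<close>, so that derivatives within
    \<open>{udd..}\<close> become two-sided, and positive, so that division by points of
    \<open>{a..}\<close> is safe.\<close>
  define a where "a = max udd 0 + 1"
  define \<phi> where "\<phi> x = indicator {0..} x * \<psi> x" for x
  define p where "p d s = u d * (1 + s / r d)" for d s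
  have a: "0 < a" "udd < a"
    by (auto simp: a_def)
  have strict: "strict_mono_on {udd..} L"
    using L_incr by (simp add: L_def)
  have L_mono: "L x \<le> L y" if "a \<le> x" "x \<le> y" for x y
    using strict_mono_onD[OF strict, of x y] that a by (cases "x = y") auto
  have at_udd: "at x within {udd..} = at x" if "a \<le> x" for x
    using that a by (intro at_within_interior) (simp add: interior_real_atLeast)
  have L_top: "filterlim L at_top at_top"
  proof -
    have "filterlim (\<lambda>x. (L x / ln x) * ln x) at_top at_top"
      using M_infty by (intro filterlim_at_top_mult_at_top ln_at_top) (simp add: L_def)
    moreover have "\<forall>\<^sub>F x in at_top. (L x / ln x) * ln x = L x"
      using eventually_gt_at_top[of 1] by eventually_elim simp
    ultimately show ?thesis
      by (simp cong: filterlim_cong)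
  qed
  have L_cont: "isCont L x" if "a \<le> x" for x
    using L_deriv[of x] at_udd[OF that] that a by (auto simp: L_def intro!: DERIV_isCont)
  \<comment> \<open>\<open>Linv\<close> is meaningful only on the range of \<open>L\<close>. The
    intermediate value theorem puts \<open>real d\<close> there, and injectivity on
    \<open>{udd..}\<close> identifies the preimage.\<close>
  have u_inv: "L (u d) = real d \<and> a \<le> u d" if d: "L a \<le> real d" for d
  proof -
    obtain b where b: "a \<le> b" "real d \<le> L b"
      using eventually_happens'[OF _ eventually_conj[OF eventually_ge_at_top[of a]
          filterlim_at_top[THEN iffD1, OF L_top, rule_format, of "real d"]]] by auto
    then obtain x where x: "a \<le> x" "L x = real d"
      using IVT[of L a "real d" b] d L_cont by auto
    then have "Linv udd L (real d) = x"
      unfolding Linv_def using a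
      by (intro the_inv_into_f_eq strict_mono_on_imp_inj_on strict) auto
    then show ?thesis
      using x by (simp add: u_def)
  qed
  have ev_d: "\<forall>\<^sub>F d in sequentially. x \<le> real d" for x
    using filterlim_real_sequentially by (simp add: filterlim_at_top)
  have Lu: "\<forall>\<^sub>F d in sequentially. L (u d) = real d"
    using ev_d[of "L a"] by eventually_elim (use u_inv in blast)
  have u_top: "filterlim u at_top sequentially"
    unfolding filterlim_at_top
  proof
    fix Z
    show "\<forall>\<^sub>F d in sequentially. Z \<le> u d"
      using ev_d[of "L a"] ev_d[of "L (max Z a) + 1"]
    proof eventually_elim
      case (elim d)
      then have "L (max Z a) < L (u d)" "a \<le> u d"
        using u_inv by auto
      then show ?case
        using L_mono[of "u d" "max Z a"] by linarith
    qed
  qed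
  have \<nu>_top: "filterlim \<nu> at_top sequentially"
    using nu_infty by (simp add: \<nu>_def[abs_def] u_def L_def)
  then have r_top: "filterlim r at_top sequentially"
    unfolding r_def[abs_def] by (rule filterlim_compose[OF sqrt_at_top])
  have \<phi>_meas [measurable]: "\<phi> \<in> borel_measurable borel"
    using psi_meas by (simp add: set_borel_measurable_def \<phi>_def[abs_def])
  have \<phi>_nonneg: "0 \<le> \<phi> x" for x
    using psi_nonneg by (simp add: \<phi>_def indicator_def)
  have \<phi>_int: "integrable lborel (\<lambda>x. x ^ d * \<phi> x)" if "1 \<le> d" for d
  proof (rule integrableI_nonneg)
    show "AE x in lborel. 0 \<le> x ^ d * \<phi> x"
      using psi_nonneg by (auto simp: \<phi>_def indicator_def)
    have "(\<integral>\<^sup>+x. ennreal (x ^ d * \<phi> x) \<partial>lborel) = (\<integral>\<^sup>+x. ennreal (x ^ d * \<psi> x) * indicator {0..} x \<partial>lborel)"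
      by (intro nn_integral_cong) (simp add: \<phi>_def indicator_def)
    then show "(\<integral>\<^sup>+x. ennreal (x ^ d * \<phi> x) \<partial>lborel) < \<infinity>"
      using moments[OF that] by simp
  qed measurable
  have \<phi>_deriv: "((\<lambda>x. - ln (\<phi> x)) has_real_derivative L x / x) (at x)" if "a \<le> x" for x
  proof -
    have "((\<lambda>x. - ln (\<psi> x)) has_real_derivative L x / x) (at x)"
      using Lambda_deriv[of x] at_udd[OF that] that a by (simp add: L_def)
    then show ?thesis
      by (rule has_field_derivative_transform_within_open[of _ _ _ "{0<..}"])
        (use that a in \<open>auto simp: \<phi>_def\<close>)
  qed
  have bound: "\<forall>\<^sub>F d in sequentially. \<forall>t. t\<^sup>2 \<le> \<omega> d \<longrightarrow>
      \<bar>L (p d t) - real d - t * r d\<bar> \<le> \<bar>t\<bar> * r d / \<omega> d"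
  proof -
    have "\<forall>\<^sub>F d in sequentially. 1 \<le> \<nu> d"
      using \<nu>_top by (simp add: filterlim_at_top)
    then show ?thesis
      using omega_bound Lu
    proof eventually_elim
      case (elim d)
      have r: "0 < r d" "r d * r d = \<nu> d" "(r d)\<^sup>2 = \<nu> d"
        using elim by (auto simp: r_def)
      show ?case
      proof (intro allI impI)
        fix t :: real assume t: "t\<^sup>2 \<le> \<omega> d"
        \<comment> \<open>Substituting \<open>\<epsilon> = - t / r d\<close> in the hypothesis:
          since \<open>r d * r d = \<nu> d\<close>, its range becomes
          \<open>t\<^sup>2 \<le> \<omega> d\<close> and its linear term
          \<open>- t * r d\<close>.\<close>
        have "(- t / r d)\<^sup>2 \<le> \<omega> d / \<nu> d"
          using t elim r by (simp add: power_divide divide_right_mono)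
        then have "\<bar>L (u d) - L ((1 - - t / r d) * u d) - - t / r d * u d * L' (u d)\<bar> \<le> \<bar>- t / r d\<bar> * \<nu> d / \<omega> d"
          using elim(2)[rule_format, of "- t / r d"] unfolding Let_def L_def[symmetric] u_def[symmetric] \<nu>_def[symmetric]
          by blast
        moreover have "(1 - - t / r d) * u d = p d t"
          by (simp add: p_def)
        moreover have "- t / r d * u d * L' (u d) = - t * r d"
        proof -
          have "- t / r d * u d * L' (u d) = - t / r d * (r d * r d)"
            unfolding r(2) \<nu>_def by simp
          then show ?thesis
            using r(1) by simp
        qed
        moreover have "\<bar>- t / r d\<bar> * \<nu> d / \<omega> d = \<bar>t\<bar> * r d / \<omega> d"
          unfolding r(2)[symmetric] using r(1) by simp
        ultimately have "\<bar>real d - L (p d t) - - t * r d\<bar> \<le> \<bar>t\<bar> * r d / \<omega> d"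
          unfolding elim(3) by metis
        then show "\<bar>L (p d t) - real d - t * r d\<bar> \<le> \<bar>t\<bar> * r d / \<omega> d"
          by argo
      qed
    qed
  qed
  define I where "I A d = (\<integral>s. indicator A s * (p d s ^ d * \<phi> (p d s) / (u d ^ d * \<phi> (u d))) \<partial>lborel)"
    for A d
  have I_lim: "I A \<longlonglongrightarrow> (\<integral>s. indicator A s * exp (- s\<^sup>2 / 2) \<partial>lborel)" if "A \<in> sets borel" for A
    unfolding I_def p_def
  proof (rule laplace_limit[OF \<phi>_meas \<phi>_nonneg _ _ a(1) _ \<phi>_deriv L_mono u_top r_top omega_infty Lu _ that])
    show "\<forall>\<^sub>F d in sequentially. \<forall>t. t\<^sup>2 \<le> \<omega> d \<longrightarrow>
        \<bar>L (u d * (1 + t / r d)) - real d - t * r d\<bar> \<le> \<bar>t\<bar> * r d / \<omega> d"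
      using bound by (simp add: p_def)
  qed (use \<phi>_int[of 1] psi_pos a in \<open>auto simp: \<phi>_def\<close>)

  have normal: "measure std_normal_distribution A = (\<integral>s. indicator A s * exp (- s\<^sup>2 / 2) \<partial>lborel) / sqrt (2 * pi)"
    if [measurable]: "A \<in> sets borel" for A
  proof -
    have "measure std_normal_distribution A = (\<integral>s. indicator A s \<partial>std_normal_distribution)"
      by simp
    also have "\<dots> = (\<integral>s. std_normal_density s *\<^sub>R indicator A s \<partial>lborel)"
      by (subst integral_density) auto
    also have "\<dots> = (\<integral>s. (indicator A s * exp (- s\<^sup>2 / 2)) / sqrt (2 * pi) \<partial>lborel)"
      by (intro Bochner_Integration.integral_cong) (auto simp: std_normal_density_def)
    finally show ?thesis
      by simp
  qed
  \<comment> \<open>The Gaussian integral is read off from the normal law having total mass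
    1.\<close>
  have total: "(\<integral>s. indicator UNIV s * exp (- s\<^sup>2 / 2) \<partial>lborel) = sqrt (2 * pi)"
  proof -
    interpret real_distribution std_normal_distribution
      by (rule real_dist_normal_dist)
    show ?thesis
      using normal[of UNIV] prob_space by (simp add: field_simps)
  qed

  have cdf_eq: "\<forall>\<^sub>F d in sequentially.
      I {..x} d / I UNIV d = cdf (distr (M d) borel (\<lambda>s. r d * (vnorm d (X d s) / u d - 1))) x" for x
  proof -
    have "\<forall>\<^sub>F d in sequentially. a \<le> u d" "\<forall>\<^sub>F d in sequentially. 1 \<le> r d"
      using u_top r_top by (simp_all add: filterlim_at_top)
    then show ?thesis
      using eventually_ge_at_top[of 1]
    proof eventually_elim
      case (elim d)
      have pos: "0 < u d" "0 < r d" "0 < u d / r d"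
        using elim a by auto
      interpret prob_space "M d"
        using prob elim by simp
      have [measurable]: "X d \<in> measurable (M d) (PiM {..d} (\<lambda>_. lborel))"
        using distr_X[OF elim(3)] by (rule distributed_measurable)
      have p_eq: "p d = (\<lambda>s. u d + u d / r d * s)"
        by (simp add: p_def fun_eq_iff algebra_simps)
      define B where "B = {v. r d * (v / u d - 1) \<le> x}"
      have B [measurable]: "B \<in> sets borel"
        unfolding B_def by measurable
      have pB: "indicator B (p d s) = (indicator {..x} s :: real)" for s
        using pos by (simp add: B_def p_def indicator_def)
      \<comment> \<open>Affine substitution \<open>v = p d s\<close>. The prefactor does not depend
        on \<open>f\<close>, so it cancels in the quotient that represents the distribution
        function.\<close>
      have subst_p: "(\<integral>v. f v * (v ^ d * \<phi> v) \<partial>lborel) =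
          (u d / r d * (u d ^ d * \<phi> (u d))) * (\<integral>s. f (p d s) * (p d s ^ d * \<phi> (p d s) / (u d ^ d * \<phi> (u d))) \<partial>lborel)"
        for f :: "real \<Rightarrow> real"
      proof -
        have "0 < \<phi> (u d)"
          using psi_pos[of "u d"] elim a by (simp add: \<phi>_def)
        then have nz: "u d ^ d * \<phi> (u d) \<noteq> 0"
          using pos by simp
        have "(\<integral>v. f v * (v ^ d * \<phi> v) \<partial>lborel) = \<bar>u d / r d\<bar> *\<^sub>R (\<integral>s. f (p d s) * (p d s ^ d * \<phi> (p d s)) \<partial>lborel)"
          unfolding p_eq using pos by (intro lborel_integral_real_affine) auto
        also have "(\<integral>s. f (p d s) * (p d s ^ d * \<phi> (p d s)) \<partial>lborel) =
            (\<integral>s. (u d ^ d * \<phi> (u d)) * (f (p d s) * (p d s ^ d * \<phi> (p d s) / (u d ^ d * \<phi> (u d)))) \<partial>lborel)"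
          using nz by (intro Bochner_Integration.integral_cong) auto
        finally show ?thesis
          using pos by simp
      qed
      have nz: "u d / r d * (u d ^ d * \<phi> (u d)) \<noteq> 0"
        using psi_pos[of "u d"] elim a pos by (simp add: \<phi>_def)
      have "cdf (distr (M d) borel (\<lambda>s. r d * (vnorm d (X d s) / u d - 1))) x =
          prob {s \<in> space (M d). vnorm d (X d s) \<in> B}"
        unfolding cdf_def by (subst measure_distr) (auto intro!: arg_cong2[where f = measure] simp: B_def)
      also have "\<dots> = measure (distr (M d) borel (\<lambda>s. vnorm d (X d s))) B"
        by (subst measure_distr) (auto intro!: arg_cong2[where f = measure])
      also have "\<dots> = (\<integral>v. indicator B v * (v ^ d * \<phi> v) \<partial>lborel) / (\<integral>v. v ^ d * \<phi> v \<partial>lborel)"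
        using \<phi>_meas \<phi>_int[OF elim(3)] unfolding \<phi>_def
        by (intro measure_radial_norm[OF _ psi_nonneg _ prob distr_X] elim B) auto
      also have "\<dots> = I {..x} d / I UNIV d"
        using subst_p[of "indicator B"] subst_p[of "\<lambda>_. 1"] nz pB by (simp add: I_def)
      finally show ?case
        by simp
    qed
  qed
  \<comment> \<open>Convergence is obtained at every \<open>x\<close>, hence in particular at the
    continuity points required by weak convergence.\<close>
  have "(\<lambda>d. cdf (distr (M d) borel (\<lambda>s. r d * (vnorm d (X d s) / u d - 1))) x)
      \<longlonglongrightarrow> cdf std_normal_distribution x" for x
  proof -
    have "(\<lambda>d. I {..x} d / I UNIV d) \<longlonglongrightarrow> cdf std_normal_distribution x"
      unfolding cdf_def normal[OF atMost_borel] total[symmetric]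
      by (intro tendsto_divide I_lim) (simp_all only: total, simp_all)
    then show ?thesis
      using cdf_eq by (rule Lim_transform_eventually)
  qed
  then show ?thesis
    unfolding weak_conv_m_def weak_conv_def Let_def
    unfolding L_def[symmetric] u_def[symmetric] \<nu>_def[symmetric] r_def[symmetric]
    by blast
qed

end
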